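(* Let $l=\{a_i;\ i=1,2,3,\dots\}$ be a bounded sequence of real numbers, i.e. there is a number $m$ such that $|a_i|<m$ for all $i\in\mathbb{N}$. Then $l$ is statistically convergent if and only if its sequence of partial averages $\mu(l)$ converges and its sequence of partial standard deviations $\sigma(l)$ converges to $0$.
   Context: $\mathbb{N}=\{1,2,3,\dots\}$. For $K\subseteq\mathbb{N}$ put $K_n=\{k\in K: k\le n\}$; the asymptotic density of $K$ is $d(K)=\lim_{n\to\infty}\frac1n|K_n|$ whenever the limit exists. A sequence $l=\{a_i\}$ of real numbers is statistically convergent to $a\in\mathbb{R}$ if for every $\varepsilon>0$ the set $\{i\in\mathbb{N}: |a_i-a|\ge\varepsilon\}$ has density $0$; it is statistically convergent if it is statistically convergent to some real number. The sequence of partial averages is $\mu(l)=\{\mu_n\}$ with $\mu_n=\frac1n\sum_{i=1}^n a_i$, and the sequence of partial standard deviations is $\sigma(l)=\{\sigma_n\}$ with $\sigma_n=\left(\frac1n\sum_{i=1}^n(a_i-\mu_n)^2\right)^{1/2}$, $n=1,2,3,\dots$. *)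

theory Defs
  imports Complex_Main
begin

(* The natural numbers start at 1 here: a sequence is a function nat => real of which only the
   values at indices i >= 1 are used, and a set of indices K is read as its part in {1, 2, ...}.
   The sequences n |-> ... below take a junk value at n = 0, which no limit depends on. *)

definition has_asymptotic_density :: "nat set \<Rightarrow> real \<Rightarrow> bool" where
  "has_asymptotic_density K d \<longleftrightarrow>
     (\<lambda>n. 1 / real n * real (card {k \<in> K. 1 \<le> k \<and> k \<le> n})) \<longlonglongrightarrow> d"

definition statistically_convergent_to :: "(nat \<Rightarrow> real) \<Rightarrow> real \<Rightarrow> bool" where
  "statistically_convergent_to a L \<longleftrightarrow>
     (\<forall>\<epsilon>>0. has_asymptotic_density {i. 1 \<le> i \<and> \<bar>a i - L\<bar> \<ge> \<epsilon>} 0)"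

definition statistically_convergent :: "(nat \<Rightarrow> real) \<Rightarrow> bool" where
  "statistically_convergent a \<longleftrightarrow> (\<exists>L. statistically_convergent_to a L)"

definition partial_average :: "(nat \<Rightarrow> real) \<Rightarrow> nat \<Rightarrow> real" where
  "partial_average a n = 1 / real n * (\<Sum>i=1..n. a i)"

definition partial_std_dev :: "(nat \<Rightarrow> real) \<Rightarrow> nat \<Rightarrow> real" where
  "partial_std_dev a n = sqrt (1 / real n * (\<Sum>i=1..n. (a i - partial_average a n)\<^sup>2))"

end

theory Submission
  imports Defs "HOL-Library.Indicator_Function"
begin

text \<open>
  Both conditions say that the mean square deviation of \<open>a\<close> from some number \<open>L\<close>, that is the
  sequence of averages of \<open>(a i - L)\<^sup>2\<close>, tends to \<open>0\<close>.

  On the statistical side, let \<open>f\<close> be the fraction of the first \<open>n\<close> indices with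
  \<open>\<bar>a i - L\<bar> \<ge> \<epsilon>\<close>, and let \<open>B\<close> bound all deviations \<open>\<bar>a i - L\<bar>\<close>. Then the mean square deviation
  is at least \<open>\<epsilon>\<^sup>2 f\<close> (Chebyshev) and at most \<open>\<epsilon>\<^sup>2 + B\<^sup>2 f\<close>, so it vanishes in the limit exactly
  if \<open>f\<close> does for every \<open>\<epsilon>\<close>; this is
  \<open>statistically_convergent_to_iff_mean_square_tendsto_0\<close>.

  On the side of averages and standard deviations, the decomposition of the second moment about
  \<open>L\<close> into variance and squared bias, \<open>mean_square_deviation_eq\<close>, writes the mean square deviation
  as a sum of two nonnegative terms, \<open>\<sigma>\<^sub>n\<^sup>2 + (\<mu>\<^sub>n - L)\<^sup>2\<close>. It vanishes in the limit exactly if both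
  terms do, that is if \<open>\<sigma>\<^sub>n\<close> tends to \<open>0\<close> and \<open>\<mu>\<^sub>n\<close> to \<open>L\<close>.
\<close>

lemma partial_average_mono:
  assumes "\<And>i. 1 \<le> i \<Longrightarrow> a i \<le> b i"
  shows "partial_average a n \<le> partial_average b n"
  unfolding partial_average_def
  by (intro mult_left_mono sum_mono) (use assms in auto)

lemma partial_average_add:
  "partial_average (\<lambda>i. a i + b i) n = partial_average a n + partial_average b n"
  by (simp add: partial_average_def sum.distrib algebra_simps add_divide_distrib)

lemma partial_average_cmult:
  "partial_average (\<lambda>i. c * a i) n = c * partial_average a n"
  by (simp add: partial_average_def flip: sum_distrib_left)

text \<open>Only an inequality, because the average of no terms is \<open>0\<close>.\<close>

lemma partial_average_const_le:
  assumes "0 \<le> c"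
  shows "partial_average (\<lambda>i. c) n \<le> c"
  using assms by (cases "n = 0") (auto simp: partial_average_def)

text \<open>A density is a limit of averages, which reduces estimates of frequencies to pointwise
  estimates by indicator functions.\<close>

lemma has_asymptotic_density_iff_average_indicator:
  "has_asymptotic_density K d \<longleftrightarrow> partial_average (indicator K) \<longlonglongrightarrow> d"
proof -
  have "real (card {k \<in> K. 1 \<le> k \<and> k \<le> n}) = (\<Sum>i=1..n. indicator K i)" for n
  proof -
    have "{k \<in> K. 1 \<le> k \<and> k \<le> n} = {1..n} \<inter> K" by auto
    then show ?thesis by (simp add: indicator_def of_bool_def sum.If_cases)
  qed
  then have "(\<lambda>n. 1 / real n * real (card {k \<in> K. 1 \<le> k \<and> k \<le> n}))
      = partial_average (indicator K)"
    by (simp add: fun_eq_iff partial_average_def)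
  then show ?thesis by (simp add: has_asymptotic_density_def)
qed

text \<open>Chebyshev's inequality for the uniform distribution on the first \<open>n\<close> indices.\<close>

lemma Chebyshev_partial_average:
  assumes "0 \<le> \<epsilon>"
  shows "\<epsilon>\<^sup>2 * partial_average (indicator {i. 1 \<le> i \<and> \<bar>a i - L\<bar> \<ge> \<epsilon>}) n
           \<le> partial_average (\<lambda>i. (a i - L)\<^sup>2) n"
proof -
  have "\<epsilon>\<^sup>2 * indicator {i. 1 \<le> i \<and> \<bar>a i - L\<bar> \<ge> \<epsilon>} i \<le> (a i - L)\<^sup>2" for i
    using assms abs_le_square_iff[of \<epsilon> "a i - L"] by (auto simp: indicator_def)
  then show ?thesis
    unfolding partial_average_cmult[symmetric] by (intro partial_average_mono)
qed

text \<open>The reverse of Chebyshev's inequality: an index contributes at most \<open>\<epsilon>\<^sup>2\<close> to the mean square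
  deviation, unless it is exceptional, and then it contributes at most \<open>B\<^sup>2\<close>. This is where
  boundedness enters: a sparse set of indices cannot carry a large mean.\<close>

lemma mean_square_deviation_le:
  assumes B: "\<And>i. 1 \<le> i \<Longrightarrow> \<bar>a i - L\<bar> \<le> B"
  shows "partial_average (\<lambda>i. (a i - L)\<^sup>2) n
           \<le> \<epsilon>\<^sup>2 + B\<^sup>2 * partial_average (indicator {i. 1 \<le> i \<and> \<bar>a i - L\<bar> \<ge> \<epsilon>}) n"
proof -
  let ?K = "{i. 1 \<le> i \<and> \<bar>a i - L\<bar> \<ge> \<epsilon>}"
  have "(a i - L)\<^sup>2 \<le> \<epsilon>\<^sup>2 + B\<^sup>2 * indicator ?K i" if "1 \<le> i" for i
  proof (cases "i \<in> ?K")
    case True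
    have "\<bar>a i - L\<bar>\<^sup>2 \<le> B\<^sup>2" by (intro power_mono B that) auto
    then have "(a i - L)\<^sup>2 \<le> B\<^sup>2" by simp
    with True show ?thesis by (simp add: add_increasing)
  next
    case False
    then have "\<bar>a i - L\<bar>\<^sup>2 \<le> \<epsilon>\<^sup>2" using that by (intro power_mono) auto
    with False show ?thesis by simp
  qed
  then have "partial_average (\<lambda>i. (a i - L)\<^sup>2) n
      \<le> partial_average (\<lambda>i. \<epsilon>\<^sup>2 + B\<^sup>2 * indicator ?K i) n"
    by (rule partial_average_mono)
  also have "\<dots> \<le> \<epsilon>\<^sup>2 + B\<^sup>2 * partial_average (indicator ?K) n"
    unfolding partial_average_add partial_average_cmult
    by (simp add: partial_average_const_le)
  finally show ?thesis .
qed

lemma statistically_convergent_to_iff_mean_square_tendsto_0: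
  assumes bounded: "\<exists>m. \<forall>i\<ge>1. \<bar>a i\<bar> < m"
  shows "statistically_convergent_to a L \<longleftrightarrow> partial_average (\<lambda>i. (a i - L)\<^sup>2) \<longlonglongrightarrow> 0"
    (is "_ \<longleftrightarrow> ?D \<longlonglongrightarrow> 0")
proof -
  define F where "F \<epsilon> = partial_average (indicator {i. 1 \<le> i \<and> \<bar>a i - L\<bar> \<ge> \<epsilon>})" for \<epsilon>
  have stat_iff: "statistically_convergent_to a L \<longleftrightarrow> (\<forall>\<epsilon>>0. F \<epsilon> \<longlonglongrightarrow> 0)"
    by (simp add: statistically_convergent_to_def has_asymptotic_density_iff_average_indicator
        F_def)
  have F_nonneg: "0 \<le> F \<epsilon> n" for \<epsilon> n
    by (auto simp: F_def partial_average_def intro!: divide_nonneg_nonneg sum_nonneg)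
  have D_nonneg: "0 \<le> ?D n" for n
    by (auto simp: partial_average_def intro!: divide_nonneg_nonneg sum_nonneg)
  show ?thesis
  proof
    assume "?D \<longlonglongrightarrow> 0"
    have "F \<epsilon> \<longlonglongrightarrow> 0" if "0 < \<epsilon>" for \<epsilon>
    proof (rule tendsto_sandwich[where f = "\<lambda>n. 0"])
      show "(\<lambda>n. ?D n / \<epsilon>\<^sup>2) \<longlonglongrightarrow> 0"
        using \<open>?D \<longlonglongrightarrow> 0\<close> by (rule tendsto_divide_zero)
      show "\<forall>\<^sub>F n in sequentially. F \<epsilon> n \<le> ?D n / \<epsilon>\<^sup>2"
        using that Chebyshev_partial_average[of \<epsilon> a L]
        by (intro always_eventually allI) (simp add: F_def pos_le_divide_eq mult.commute)
    qed (auto simp: F_nonneg)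
    then show "statistically_convergent_to a L" by (simp add: stat_iff)
  next
    assume "statistically_convergent_to a L"
    then have F: "F \<epsilon> \<longlonglongrightarrow> 0" if "0 < \<epsilon>" for \<epsilon> using that by (simp add: stat_iff)
    obtain m where m: "\<And>i. 1 \<le> i \<Longrightarrow> \<bar>a i\<bar> < m" using bounded by auto
    define B where "B = m + \<bar>L\<bar>"
    have B: "\<bar>a i - L\<bar> \<le> B" if "1 \<le> i" for i using m[OF that] by (simp add: B_def)
    show "?D \<longlonglongrightarrow> 0"
    proof (rule order_tendstoI)
      fix r :: real assume "0 < r"
      \<comment> \<open>With this threshold the unexceptional indices contribute at most \<open>r / 2\<close>.\<close>
      define \<epsilon> where "\<epsilon> = sqrt (r / 2)"
      have \<epsilon>: "0 < \<epsilon>" "\<epsilon>\<^sup>2 = r / 2" using \<open>0 < r\<close> by (simp_all add: \<epsilon>_def)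
      have "(\<lambda>n. B\<^sup>2 * F \<epsilon> n) \<longlonglongrightarrow> 0"
        using F[OF \<epsilon>(1)] by (rule tendsto_mult_right_zero)
      then have "\<forall>\<^sub>F n in sequentially. B\<^sup>2 * F \<epsilon> n < r / 2"
        by (rule order_tendstoD) (use \<open>0 < r\<close> in simp)
      then show "\<forall>\<^sub>F n in sequentially. ?D n < r"
      proof eventually_elim
        case (elim n)
        have "?D n \<le> \<epsilon>\<^sup>2 + B\<^sup>2 * F \<epsilon> n"
          unfolding F_def by (rule mean_square_deviation_le[OF B])
        with elim \<epsilon>(2) show ?case by linarith
      qed
    next
      fix r :: real assume "r < 0"
      then show "\<forall>\<^sub>F n in sequentially. r < ?D n"
        using D_nonneg by (intro always_eventually allI) (rule less_le_trans)
    qed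
  qed
qed

text \<open>Expanding \<open>(a i - L)\<^sup>2\<close> about the mean, the mixed terms cancel because the deviations from
  the mean sum to \<open>0\<close>.\<close>

lemma mean_square_deviation_eq:
  assumes "1 \<le> n"
  shows "partial_average (\<lambda>i. (a i - L)\<^sup>2) n
           = (partial_std_dev a n)\<^sup>2 + (partial_average a n - L)\<^sup>2"
proof -
  define \<mu> where "\<mu> = partial_average a n"
  have sum_a: "(\<Sum>i=1..n. a i) = real n * \<mu>"
    using assms by (auto simp: \<mu>_def partial_average_def)
  have "(\<Sum>i=1..n. (a i - L)\<^sup>2)
      = (\<Sum>i=1..n. (a i - \<mu>)\<^sup>2 + 2 * (\<mu> - L) * (a i - \<mu>) + (\<mu> - L)\<^sup>2)"
    by (intro sum.cong refl) (simp add: power2_eq_square algebra_simps)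
  also have "\<dots> = (\<Sum>i=1..n. (a i - \<mu>)\<^sup>2) + 2 * (\<mu> - L) * (\<Sum>i=1..n. (a i - \<mu>))
      + real n * (\<mu> - L)\<^sup>2"
    by (simp add: sum.distrib flip: sum_distrib_left)
  also have "(\<Sum>i=1..n. (a i - \<mu>)) = 0"
    using sum_a by (simp add: sum_subtractf)
  finally have "(\<Sum>i=1..n. (a i - L)\<^sup>2) = (\<Sum>i=1..n. (a i - \<mu>)\<^sup>2) + real n * (\<mu> - L)\<^sup>2"
    by simp
  moreover have "(partial_std_dev a n)\<^sup>2 = 1 / real n * (\<Sum>i=1..n. (a i - \<mu>)\<^sup>2)"
    unfolding partial_std_dev_def \<mu>_def
    by (intro real_sqrt_pow2 mult_nonneg_nonneg sum_nonneg) auto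
  ultimately show ?thesis
    using assms by (simp add: partial_average_def[of "\<lambda>i. (a i - L)\<^sup>2"] add_divide_distrib
        flip: \<mu>_def)
qed

lemma sum_of_squares_tendsto_0_iff:
  fixes f g :: "'a \<Rightarrow> real"
  shows "((\<lambda>x. (f x)\<^sup>2 + (g x)\<^sup>2) \<longlongrightarrow> 0) F \<longleftrightarrow> (f \<longlongrightarrow> 0) F \<and> (g \<longlongrightarrow> 0) F"
proof (intro iffI conjI)
  assume sum: "((\<lambda>x. (f x)\<^sup>2 + (g x)\<^sup>2) \<longlongrightarrow> 0) F"
  have sqrt: "((\<lambda>x. sqrt ((f x)\<^sup>2 + (g x)\<^sup>2)) \<longlongrightarrow> 0) F"
    using tendsto_real_sqrt[OF sum] by simp
  show "(f \<longlongrightarrow> 0) F"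
    by (rule tendsto_0_le[OF sqrt, where K = 1]) (simp add: real_le_rsqrt)
  show "(g \<longlongrightarrow> 0) F"
    by (rule tendsto_0_le[OF sqrt, where K = 1]) (simp add: real_le_rsqrt)
next
  assume "(f \<longlongrightarrow> 0) F \<and> (g \<longlongrightarrow> 0) F"
  then have "((\<lambda>x. (f x)\<^sup>2 + (g x)\<^sup>2) \<longlongrightarrow> 0\<^sup>2 + 0\<^sup>2) F"
    by (intro tendsto_add tendsto_power) auto
  then show "((\<lambda>x. (f x)\<^sup>2 + (g x)\<^sup>2) \<longlongrightarrow> 0) F" by simp
qed

lemma mean_square_tendsto_0_iff:
  "partial_average (\<lambda>i. (a i - L)\<^sup>2) \<longlonglongrightarrow> 0
     \<longleftrightarrow> partial_average a \<longlonglongrightarrow> L \<and> partial_std_dev a \<longlonglongrightarrow> 0"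
proof -
  have "partial_average (\<lambda>i. (a i - L)\<^sup>2) \<longlonglongrightarrow> 0
      \<longleftrightarrow> (\<lambda>n. (partial_std_dev a n)\<^sup>2 + (partial_average a n - L)\<^sup>2) \<longlonglongrightarrow> 0"
    by (intro tendsto_cong eventually_sequentiallyI[of 1] mean_square_deviation_eq)
  also have "\<dots> \<longleftrightarrow> partial_average a \<longlonglongrightarrow> L \<and> partial_std_dev a \<longlonglongrightarrow> 0"
    by (auto simp: sum_of_squares_tendsto_0_iff LIM_zero_iff)
  finally show ?thesis .
qed

theorem theorem2p5:
  fixes a :: "nat \<Rightarrow> real"
  assumes bounded: "\<exists>m. \<forall>i\<ge>1. \<bar>a i\<bar> < m"
  shows "statistically_convergent a \<longleftrightarrow>
           convergent (partial_average a) \<and> partial_std_dev a \<longlonglongrightarrow> 0"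
  by (auto simp: statistically_convergent_def convergent_def mean_square_tendsto_0_iff
      statistically_convergent_to_iff_mean_square_tendsto_0[OF bounded])

end
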